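(* For every odd integer $t\geq 1$ there exist integers $a_{t,0},\dots,a_{t,7}$ and formal power series $F_{t,0},\dots,F_{t,7}\in\mathbb{Z}[[x]]$ such that $$\left(\phi(q)\,\phi(q^2)^2\,\phi(q^4)^4\right)^t=\sum_{j=0}^{7}a_{t,j}\,q^j\,F_{t,j}(q^8),$$ and $a_{t,1}\equiv 0 \pmod 2$, $a_{t,2}\equiv 0 \pmod 4$, $a_{t,3}\equiv 0\pmod 8$, $a_{t,4}\equiv 0\pmod 2$, $a_{t,5}\equiv 0\pmod 8$, $a_{t,6}\equiv 0\pmod 8$, $a_{t,7}\equiv 0\pmod{32}$.
   Context: Ramanujan's theta function is $\phi(q)=\sum_{k=-\infty}^{\infty}q^{k^2}$, viewed as a formal power series in $q$ with integer coefficients. *)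

theory Defs
  imports
    "HOL-Analysis.Infinite_Sum"
    "HOL-Computational_Algebra.Formal_Power_Series"
    "HOL-Number_Theory.Cong"
begin

text \<open>The infinite sum is taken in the usual topology on formal power series; convergence is shown
  below (\<open>infsum\<close> would otherwise be 0).\<close>

definition ramanujan_phi :: "int fps" where
  "ramanujan_phi = (\<Sum>\<^sub>\<infinity>k\<in>(UNIV :: int set). fps_X ^ nat (k\<^sup>2))"

lemma ramanujan_phi_has_sum_aux:
  "((\<lambda>k::int. (fps_X :: int fps) ^ nat (k\<^sup>2)) has_sum
     Abs_fps (\<lambda>n. int (card {k::int. k\<^sup>2 = int n}))) UNIV"
  unfolding has_sum_def
proof (rule tendsto_fpsI)
  fix n :: nat
  have "k \<in> {- int n..int n}" if "k\<^sup>2 = int n" for k :: int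
  proof -
    have "\<bar>k\<bar> \<le> \<bar>k\<bar> * \<bar>k\<bar>"
    proof (cases "k = 0")
      case False
      then have "1 \<le> \<bar>k\<bar>" by simp
      from mult_left_mono[OF this abs_ge_zero[of k]] show ?thesis by simp
    qed simp
    also have "\<dots> = int n"
      using that by (simp add: power2_eq_square)
    finally show ?thesis by auto
  qed
  then have "{k::int. k\<^sup>2 = int n} \<subseteq> {- int n..int n}"
    by blast
  then have fin: "finite {k::int. k\<^sup>2 = int n}"
    by (rule finite_subset) simp
  show "\<forall>\<^sub>F S in finite_subsets_at_top UNIV.
    fps_nth (\<Sum>k\<in>S. (fps_X :: int fps) ^ nat (k\<^sup>2)) n =
      fps_nth (Abs_fps (\<lambda>n. int (card {k::int. k\<^sup>2 = int n}))) n"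
    unfolding eventually_finite_subsets_at_top
  proof (intro exI[of _ "{k::int. k\<^sup>2 = int n}"] conjI allI impI)
    fix S :: "int set"
    assume S: "finite S \<and> {k. k\<^sup>2 = int n} \<subseteq> S \<and> S \<subseteq> UNIV"
    have "fps_nth (\<Sum>k\<in>S. (fps_X :: int fps) ^ nat (k\<^sup>2)) n = (\<Sum>k\<in>S. if k\<^sup>2 = int n then 1 else 0)"
      unfolding fps_sum_nth fps_X_power_nth
    proof (rule sum.cong[OF refl])
      fix k :: int
      have "n = nat (k\<^sup>2) \<longleftrightarrow> k\<^sup>2 = int n"
        using zero_le_power2[of k] by linarith
      then show "(if n = nat (k\<^sup>2) then 1 else 0 :: int) = (if k\<^sup>2 = int n then 1 else 0)"
        by simp
    qed
    also have "\<dots> = (\<Sum>k\<in>S \<inter> {k. k\<^sup>2 = int n}. 1)"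
      using S by (simp add: sum.If_cases)
    also have "S \<inter> {k. k\<^sup>2 = int n} = {k. k\<^sup>2 = int n}"
      using S by blast
    finally show "fps_nth (\<Sum>k\<in>S. (fps_X :: int fps) ^ nat (k\<^sup>2)) n =
      fps_nth (Abs_fps (\<lambda>n. int (card {k::int. k\<^sup>2 = int n}))) n"
      by simp
  qed (use fin in auto)
qed

lemma ramanujan_phi_has_sum:
  "((\<lambda>k::int. (fps_X :: int fps) ^ nat (k\<^sup>2)) has_sum ramanujan_phi) UNIV"
  unfolding ramanujan_phi_def
  by (rule has_sum_infsum[OF has_sum_imp_summable[OF ramanujan_phi_has_sum_aux]])

lemma ramanujan_phi_nth: "fps_nth ramanujan_phi n = int (card {k::int. k\<^sup>2 = int n})"
  unfolding ramanujan_phi_def infsumI[OF ramanujan_phi_has_sum_aux] by simp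

end

(* Attach to each residue class j mod 8 a modulus dividing every coefficient with index in that
   class. These moduli propagate through products and, with the cross terms counted twice,
   through squares. Starting from the fact that phi is 1 plus twice a series supported on the
   squares (residues 0, 1, 4), one gets the moduli 1, 2, 4, 8, 2, 8, 8, 32 for the product G.
   Squaring G gives 1, 4, 4, 16, 4, 8, 16, 32, and multiplication by such a series preserves the
   moduli of G, so all odd powers of G have them. *)

theory Submission
  imports Defs "HOL-Computational_Algebra.Formal_Laurent_Series"
begin

(* The modulus 0 encodes that the coefficients in the class vanish. *)
definition residue_dvd :: "nat \<Rightarrow> (nat \<Rightarrow> int) \<Rightarrow> int fps \<Rightarrow> bool" where
  "residue_dvd m d f \<longleftrightarrow> (\<forall>n. d (n mod m) dvd fps_nth f n)"

lemma residue_dvdD: "residue_dvd m d f \<Longrightarrow> d (n mod m) dvd fps_nth f n"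
  by (simp add: residue_dvd_def)

text \<open>Each term of the Cauchy product at index \<open>n\<close> pairs two indices whose
  residues add up to \<open>n\<close> modulo \<open>m\<close>, so it suffices to check the finitely
  many pairs of classes.\<close>

lemma residue_dvd_mult:
  assumes f: "residue_dvd m a f" and g: "residue_dvd m b g" and m: "m > 0"
    and c: "\<forall>i<m. \<forall>j<m. c ((i + j) mod m) dvd a i * b j"
  shows "residue_dvd m c (f * g)"
  unfolding residue_dvd_def fps_mult_nth
proof (intro allI dvd_sum)
  fix n i :: nat
  assume "i \<in> {0..n}"
  then have "(i mod m + (n - i) mod m) mod m = n mod m"
    by (simp add: mod_add_eq)
  with c m have "c (n mod m) dvd a (i mod m) * b ((n - i) mod m)"
    by (metis mod_less_divisor)
  also have "\<dots> dvd fps_nth f i * fps_nth g (n - i)"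
    by (intro mult_dvd_mono residue_dvdD f g)
  finally show "c (n mod m) dvd fps_nth f i * fps_nth g (n - i)" .
qed

text \<open>The reflection \<open>i\<close> to \<open>n - i\<close> matches the terms below the
  middle with those above it, which gives the factor 2. Only a middle index, present for even
  \<open>n\<close>, stays unpaired.\<close>

lemma fps_square_nth:
  fixes f :: "'a::comm_ring_1 fps"
  shows "fps_nth (f\<^sup>2) n = 2 * (\<Sum>i | 2 * i < n. fps_nth f i * fps_nth f (n - i)) +
           (if even n then (fps_nth f (n div 2))\<^sup>2 else 0)"
proof -
  let ?t = "\<lambda>i. fps_nth f i * fps_nth f (n - i)"
  let ?L = "{i. 2 * i < n}" and ?M = "{i. 2 * i = n}" and ?U = "{i. n < 2 * i \<and> i \<le> n}"
  have fin: "finite ?L" "finite ?M" "finite ?U"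
    by (auto intro: finite_subset[of _ "{..n}"])
  have split: "{0..n} = (?L \<union> ?M) \<union> ?U"
    by auto
  have "sum ?t ?U = sum ?t ?L"
    by (rule sum.reindex_bij_witness[of _ "\<lambda>i. n - i" "\<lambda>i. n - i"]) (auto simp: mult.commute)
  moreover have "sum ?t ?M = (if even n then (fps_nth f (n div 2))\<^sup>2 else 0)"
  proof (cases "even n")
    case True
    then obtain k where k: "n = 2 * k" ..
    then have "?M = {k}" by auto
    with k show ?thesis by (simp add: power2_eq_square)
  next
    case False
    then have "?M = {}" by auto
    with False show ?thesis by (simp only: sum.empty if_False)
  qed
  moreover have "fps_nth (f\<^sup>2) n = sum ?t ?L + sum ?t ?M + sum ?t ?U"
    unfolding power2_eq_square fps_mult_nth split
    using fin by (subst sum.union_disjoint, simp, simp, force)+ (rule refl)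
  ultimately show ?thesis by simp
qed

text \<open>Terms off the middle carry an extra factor 2, also when both indices lie in the same
  class; hence \<open>cross\<close> includes \<open>i = j\<close>. The middle term lacks this factor
  and is covered by \<open>diag\<close>.\<close>

lemma residue_dvd_square:
  assumes f: "residue_dvd m a f" and m: "m > 0"
    and cross: "\<forall>i<m. \<forall>j<m. c ((i + j) mod m) dvd 2 * a i * a j"
    and diag: "\<forall>i<m. c ((i + i) mod m) dvd a i * a i"
  shows "residue_dvd m c (f\<^sup>2)"
  unfolding residue_dvd_def
proof
  fix n
  have "c (n mod m) dvd 2 * (fps_nth f i * fps_nth f (n - i))" if "2 * i < n" for i
  proof -
    have "(i mod m + (n - i) mod m) mod m = n mod m"
      using that by (simp add: mod_add_eq)
    with cross m have "c (n mod m) dvd 2 * a (i mod m) * a ((n - i) mod m)"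
      by (metis mod_less_divisor)
    also have "\<dots> dvd 2 * fps_nth f i * fps_nth f (n - i)"
      by (intro mult_dvd_mono residue_dvdD f dvd_refl)
    finally show ?thesis by (simp add: mult.assoc)
  qed
  then have "c (n mod m) dvd 2 * (\<Sum>i | 2 * i < n. fps_nth f i * fps_nth f (n - i))"
    unfolding sum_distrib_left by (intro dvd_sum) simp
  moreover have "c (n mod m) dvd (fps_nth f (n div 2))\<^sup>2" if "even n"
  proof -
    from that obtain k where k: "n = k + k" by (metis evenE mult_2)
    then have "(k mod m + k mod m) mod m = n mod m"
      by (simp add: mod_add_eq)
    with diag m have "c (n mod m) dvd a (k mod m) * a (k mod m)"
      by (metis mod_less_divisor)
    also have "\<dots> dvd fps_nth f k * fps_nth f k"
      by (intro mult_dvd_mono residue_dvdD f)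
    finally show ?thesis
      using k by (simp add: power2_eq_square)
  qed
  ultimately show "c (n mod m) dvd fps_nth (f\<^sup>2) n"
    unfolding fps_square_nth by simp
qed

lemma residue_dvd_compose_X_power:
  assumes f: "residue_dvd m a f" and m: "m > 0"
    and c: "\<forall>j<m. c (k * j mod m) dvd a j"
  shows "residue_dvd m c (f oo fps_X ^ k)"
  unfolding residue_dvd_def
proof
  fix n
  show "c (n mod m) dvd fps_nth (f oo fps_X ^ k) n"
  proof (cases "k dvd n")
    case True
    then have "k * (n div k mod m) mod m = n mod m"
      by (simp add: mod_mult_right_eq)
    with c m have "c (n mod m) dvd a (n div k mod m)"
      by (metis mod_less_divisor)
    also have "\<dots> dvd fps_nth f (n div k)"
      by (intro residue_dvdD f)
    finally show ?thesis using True by (simp add: fps_nth_compose_X_power)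
  qed (simp add: fps_nth_compose_X_power)
qed

text \<open>Sorting the coefficients by residue class and pulling the modulus out of each class
  gives the shape required by the theorem.\<close>

lemma residue_dvd_decomposition:
  assumes f: "residue_dvd (Suc m) d f"
  shows "\<exists>F. f = (\<Sum>j=0..m. fps_const (d j) * fps_X ^ j * (F j oo fps_X ^ Suc m))"
proof -
  \<comment> \<open>The division is exact for \<open>j \<le> m\<close>. If \<open>d j = 0\<close>,
    the whole class vanishes, and division by 0 yields 0, so multiplying back by \<open>d j\<close>
    is still correct.\<close>
  define F where "F j = Abs_fps (\<lambda>n. fps_nth f (Suc m * n + j) div d j)" for j
  have "f = (\<Sum>j=0..m. fps_const (d j) * fps_X ^ j * (F j oo fps_X ^ Suc m))"
  proof (rule fps_ext)
    fix n
    define r where "r = n mod Suc m"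
    have "r < Suc m" unfolding r_def by (rule mod_less_divisor) simp
    then have r: "r \<in> {0..m}" "r \<le> n" "Suc m dvd n - r"
      unfolding r_def by (simp_all only: atLeastAtMost_iff less_Suc_eq_le le0 mod_less_eq_dividend
          dvd_minus_mod simp_thms)
    have nth: "fps_nth (fps_const (d j) * fps_X ^ j * (F j oo fps_X ^ Suc m)) n =
        (if j \<le> n \<and> Suc m dvd n - j then d j * fps_nth (F j) ((n - j) div Suc m) else 0)" for j
      unfolding mult.assoc fps_mult_left_const_nth fps_X_power_mult_nth fps_nth_compose_X_power
      by (simp del: power_Suc)
    have r_iff: "j \<le> n \<and> Suc m dvd n - j \<longleftrightarrow> j = r" if "j \<in> {0..m}" for j
    proof
      assume j: "j \<le> n \<and> Suc m dvd n - j"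
      then obtain q where "n - j = Suc m * q" by (elim conjE dvdE)
      with j have "n = j + Suc m * q" by linarith
      then have "n mod Suc m = j mod Suc m" by (simp only: mod_mult_self2)
      with that show "j = r" by (simp add: r_def)
    qed (use r(2,3) in blast)
    have "fps_nth (\<Sum>j=0..m. fps_const (d j) * fps_X ^ j * (F j oo fps_X ^ Suc m)) n =
        (\<Sum>j=0..m. if j = r then d j * fps_nth (F j) ((n - j) div Suc m) else 0)"
      unfolding fps_sum_nth nth by (rule sum.cong[OF refl]) (simp only: r_iff)
    also have "\<dots> = d r * fps_nth (F r) ((n - r) div Suc m)"
      using r(1) by (simp add: sum.delta)
    also have "\<dots> = d r * (fps_nth f n div d r)"
      using r(2,3) unfolding F_def by (simp add: dvd_mult_div_cancel del: mult_Suc)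
    also have "\<dots> = fps_nth f n"
      using residue_dvdD[OF f, of n] by (simp add: r_def)
    finally show "fps_nth f n =
        fps_nth (\<Sum>j=0..m. fps_const (d j) * fps_X ^ j * (F j oo fps_X ^ Suc m)) n" ..
  qed
  then show ?thesis by blast
qed

text \<open>The square roots of \<open>n\<close> come in pairs \<open>k\<close>, \<open>- k\<close>,
  distinct because \<open>n\<close> is positive.\<close>

lemma even_ramanujan_phi_nth:
  assumes "n > 0"
  shows "even (fps_nth ramanujan_phi n)"
proof (cases "\<exists>k::int. k\<^sup>2 = int n")
  case True
  then obtain k :: int where k: "k\<^sup>2 = int n" by blast
  then have "{l::int. l\<^sup>2 = int n} = {k, - k}"
    by (auto simp: power2_eq_iff simp flip: k)
  moreover have "k \<noteq> - k" using k assms by auto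
  ultimately show ?thesis by (simp add: ramanujan_phi_nth)
next
  case False
  then show ?thesis by (simp add: ramanujan_phi_nth)
qed

lemma square_mod_8: "(k::int)\<^sup>2 mod 8 \<in> {0, 1, 4}"
proof -
  have "k mod 8 \<in> {0..<8}" by simp
  then have "k mod 8 \<in> set [0..7]" by simp
  then have "(k mod 8)\<^sup>2 mod 8 \<in> {0, 1, 4}"
    by (auto simp: upto.simps)
  then show ?thesis by (simp add: power_mod)
qed

lemma ramanujan_phi_nth_eq_0:
  assumes "n mod 8 \<notin> {0, 1, 4}"
  shows "fps_nth ramanujan_phi n = 0"
proof -
  have "k\<^sup>2 \<noteq> int n" for k :: int
    using square_mod_8[of k] assms by (auto simp: zmod_int) presburger+
  then show ?thesis by (simp add: ramanujan_phi_nth)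
qed

text \<open>Class 0 contains the constant term 1, so its modulus can only be 1.\<close>

lemma residue_dvd_ramanujan_phi: "residue_dvd 8 ((!) [1, 2, 0, 0, 2, 0, 0, 0]) ramanujan_phi"
  unfolding residue_dvd_def
proof
  fix n :: nat
  have "n mod 8 < 8" by simp
  then consider "n mod 8 = 0" | "n mod 8 \<in> {1, 4}" | "n mod 8 \<in> {2, 3, 5, 6, 7}"
    by fastforce
  then show "[1, 2, 0, 0, 2, 0, 0, 0] ! (n mod 8) dvd fps_nth ramanujan_phi n"
  proof cases
    case 2
    then have "n > 0" by (intro gr0I) simp
    then show ?thesis using 2 even_ramanujan_phi_nth[of n] by auto
  next
    case 3
    then show ?thesis using ramanujan_phi_nth_eq_0[of n] by auto
  qed simp
qed

text \<open>Turns the side conditions on pairs of classes into finitely many numeric divisibilities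
  that simplification decides.\<close>

lemma all_less_8:
  "(\<forall>i<8::nat. P i) \<longleftrightarrow> P 0 \<and> P 1 \<and> P 2 \<and> P 3 \<and> P 4 \<and> P 5 \<and> P 6 \<and> P 7"
  by (simp add: eval_nat_numeral All_less_Suc) blast

abbreviation (input) ramanujan_phi_product :: "int fps" where
  "ramanujan_phi_product \<equiv>
     ramanujan_phi * (ramanujan_phi oo fps_X ^ 2) ^ 2 * (ramanujan_phi oo fps_X ^ 4) ^ 4"

lemma residue_dvd_ramanujan_phi_product:
  "residue_dvd 8 ((!) [1, 2, 4, 8, 2, 8, 8, 32]) ramanujan_phi_product"
proof -
  have "residue_dvd 8 ((!) [1, 0, 2, 0, 0, 0, 0, 0]) (ramanujan_phi oo fps_X ^ 2)"
    by (rule residue_dvd_compose_X_power[OF residue_dvd_ramanujan_phi], simp_all add: all_less_8)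
  \<comment> \<open>Class 4 gets only 4, from the middle terms in class 2, where no doubling
    helps.\<close>
  then have phi2: "residue_dvd 8 ((!) [1, 0, 4, 0, 4, 0, 0, 0]) ((ramanujan_phi oo fps_X ^ 2)\<^sup>2)"
    by (rule residue_dvd_square, simp_all add: all_less_8)
  have "residue_dvd 8 ((!) [1, 0, 0, 0, 2, 0, 0, 0]) (ramanujan_phi oo fps_X ^ 4)"
    by (rule residue_dvd_compose_X_power[OF residue_dvd_ramanujan_phi], simp_all add: all_less_8)
  \<comment> \<open>The fourth power is taken as two squarings; each doubles the modulus of class
    4.\<close>
  then have "residue_dvd 8 ((!) [1, 0, 0, 0, 4, 0, 0, 0]) ((ramanujan_phi oo fps_X ^ 4)\<^sup>2)"
    by (rule residue_dvd_square, simp_all add: all_less_8)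
  then have "residue_dvd 8 ((!) [1, 0, 0, 0, 8, 0, 0, 0]) (((ramanujan_phi oo fps_X ^ 4)\<^sup>2)\<^sup>2)"
    by (rule residue_dvd_square, simp_all add: all_less_8)
  then have phi4: "residue_dvd 8 ((!) [1, 0, 0, 0, 8, 0, 0, 0]) ((ramanujan_phi oo fps_X ^ 4) ^ 4)"
    by (simp flip: power_mult)
  \<comment> \<open>Class 7 is empty here: no element of {0, 1, 4} plus one of {0, 2, 4} is 7 modulo
    8.\<close>
  have "residue_dvd 8 ((!) [1, 2, 4, 8, 2, 8, 8, 0])
      (ramanujan_phi * (ramanujan_phi oo fps_X ^ 2)\<^sup>2)"
    by (rule residue_dvd_mult[OF residue_dvd_ramanujan_phi phi2], simp_all add: all_less_8)
  \<comment> \<open>Class 7 is now reached only from classes 3 and 4, which would even give 64; 32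
    is the value that the odd powers retain below.\<close>
  then show ?thesis
    by (rule residue_dvd_mult[OF _ phi4], simp_all add: all_less_8)
qed

text \<open>Multiplying two series with these moduli guarantees only 4 in class 5 and 16 in class 7.
  The factors 2 gained by squaring \<open>f\<close> in classes 1, 3, 4 and 6 make up for this
  loss.\<close>

lemma residue_dvd_odd_power:
  assumes f: "residue_dvd 8 ((!) [1, 2, 4, 8, 2, 8, 8, 32]) f"
  shows "residue_dvd 8 ((!) [1, 2, 4, 8, 2, 8, 8, 32]) (f ^ (2 * k + 1))"
proof (induction k)
  case (Suc k)
  have "residue_dvd 8 ((!) [1, 4, 4, 16, 4, 8, 16, 32]) (f\<^sup>2)"
    by (rule residue_dvd_square[OF f], simp_all add: all_less_8)
  then have "residue_dvd 8 ((!) [1, 2, 4, 8, 2, 8, 8, 32]) (f\<^sup>2 * f ^ (2 * k + 1))"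
    by (rule residue_dvd_mult[OF _ Suc], simp_all add: all_less_8)
  then show ?case by (simp add: power2_eq_square mult.assoc)
qed (use f in simp)

theorem theorem2p2:
  fixes t :: nat
  assumes "odd t" and "t \<ge> 1"
  shows "\<exists>(a :: nat \<Rightarrow> int) (F :: nat \<Rightarrow> int fps).
    (ramanujan_phi * (ramanujan_phi oo fps_X ^ 2) ^ 2 * (ramanujan_phi oo fps_X ^ 4) ^ 4) ^ t
      = (\<Sum>j=0..7. fps_const (a j) * fps_X ^ j * (F j oo fps_X ^ 8)) \<and>
    [a 1 = 0] (mod 2) \<and> [a 2 = 0] (mod 4) \<and> [a 3 = 0] (mod 8) \<and> [a 4 = 0] (mod 2) \<and>
    [a 5 = 0] (mod 8) \<and> [a 6 = 0] (mod 8) \<and> [a 7 = 0] (mod 32)"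
proof -
  \<comment> \<open>The moduli themselves serve as the integers \<open>a j\<close>, for every odd
    \<open>t\<close>, so the congruences are immediate.\<close>
  let ?d = "(!) [1, 2, 4, 8, 2, 8, 8, 32 :: int]"
  have Suc7: "Suc 7 = 8" by simp
  obtain k where "t = 2 * k + 1" using \<open>odd t\<close> by (rule oddE)
  then have "residue_dvd (Suc 7) ?d (ramanujan_phi_product ^ t)"
    unfolding Suc7 using residue_dvd_odd_power[OF residue_dvd_ramanujan_phi_product, of k]
    by simp
  from residue_dvd_decomposition[OF this] obtain F where
    "ramanujan_phi_product ^ t = (\<Sum>j=0..7. fps_const (?d j) * fps_X ^ j * (F j oo fps_X ^ 8))"
    unfolding Suc7 by blast
  then show ?thesis
    by (intro exI[of _ ?d] exI[of _ F]) (simp add: cong_def)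
qed

end
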